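(* Let $0\le k\le n$, let $\sigma\in\mathcal{S}_k$ be a permutation, let $\tau\in\mathcal{C}_{n-k}$ be a nilpotent partial transformation, and let $f=\mathrm{diag}(\sigma,\tau)$. Then the stabilizer of $f$ in $\mathcal{S}_n$ under conjugation decomposes as $$\mathrm{Stab}_{\mathcal{S}_n}(f)=Z(\sigma)\times \mathrm{Stab}_{\mathcal{S}_{n-k}}(\tau),$$ where $Z(\sigma)$ is the centralizer of $\sigma$ in $\mathcal{S}_k$, $\mathrm{Stab}_{\mathcal{S}_{n-k}}(\tau)=\{\rho\in\mathcal{S}_{n-k}:\rho\tau\rho^{-1}=\tau\}$, and $\mathcal{S}_k\times\mathcal{S}_{n-k}$ is embedded in $\mathcal{S}_n$ as the permutations preserving $\{1,\dots,k\}$ (the second factor acting on $\{k+1,\dots,n\}$ via $j\mapsto k+j$).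
   Context: $[n]=\{1,\dots,n\}$. A partial transformation of $[n]$ is a map $f\colon A\to[n]$ defined on a subset $A=\mathrm{dom}(f)\subseteq[n]$; $\mathcal{P}_n$ is the set of these, with composition $(fg)(i)=f(g(i))$, defined exactly when $i\in\mathrm{dom}(g)$ and $g(i)\in\mathrm{dom}(f)$. $\mathcal{S}_n$ acts on $\mathcal{P}_n$ by conjugation $f\mapsto\pi f\pi^{-1}$, and $\mathrm{Stab}_{\mathcal{S}_n}(f)=\{\pi\in\mathcal{S}_n:\pi f\pi^{-1}=f\}$. A partial transformation is nilpotent if some power of it is the empty map; $\mathcal{C}_p$ is the set of nilpotent partial transformations of $[p]$. For $\sigma\in\mathcal{S}_k$ and $\tau\in\mathcal{P}_{n-k}$, $\mathrm{diag}(\sigma,\tau)\in\mathcal{P}_n$ is the partial transformation with value $\sigma(i)$ at $1\le i\le k$, value $k+\tau(j)$ at $k+j$ for $j\in\mathrm{dom}(\tau)$, and undefined at $k+j$ for $j\notin\mathrm{dom}(\tau)$. *)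

theory Defs
  imports "HOL-Algebra.Sym_Groups" "HOL-Algebra.Group_Action"
begin

text \<open>Partial transformations of \<open>{1..n}\<close> are partial maps that are undefined outside
  \<open>{1..n}\<close>; permutations of \<open>{1..n}\<close> are, as in \<^const>\<open>sym_group\<close>, total functions on
  \<^typ>\<open>nat\<close> that fix everything outside \<open>{1..n}\<close>. The embedding \<open>pt_of_perm\<close> passes from the
  latter to the former.\<close>

definition partial_trans :: "nat \<Rightarrow> (nat \<rightharpoonup> nat) set"
  where "partial_trans n = {f. dom f \<subseteq> {1..n} \<and> ran f \<subseteq> {1..n}}"

definition pt_of_perm :: "nat \<Rightarrow> (nat \<Rightarrow> nat) \<Rightarrow> (nat \<rightharpoonup> nat)"
  where "pt_of_perm n p = (\<lambda>i. if i \<in> {1..n} then Some (p i) else None)"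

definition PT :: "nat \<Rightarrow> (nat \<rightharpoonup> nat) monoid"
  where "PT n = \<lparr>carrier = partial_trans n, mult = (\<circ>\<^sub>m), one = pt_of_perm n id\<rparr>"

definition nilpotent_pts :: "nat \<Rightarrow> (nat \<rightharpoonup> nat) set"
  where "nilpotent_pts n =
    {f \<in> carrier (PT n). \<exists>m::nat. f [^]\<^bsub>PT n\<^esub> m = Map.empty}"

text \<open>Restricted to \<open>partial_trans n\<close> because the library's group actions are by extensional
  bijections.\<close>

definition conj_pt :: "nat \<Rightarrow> (nat \<Rightarrow> nat) \<Rightarrow> (nat \<rightharpoonup> nat) \<Rightarrow> (nat \<rightharpoonup> nat)"
  where "conj_pt n p = (\<lambda>f \<in> carrier (PT n).
    pt_of_perm n p \<otimes>\<^bsub>PT n\<^esub> f \<otimes>\<^bsub>PT n\<^esub> pt_of_perm n (inv\<^bsub>sym_group n\<^esub> p))"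

abbreviation Stab :: "nat \<Rightarrow> (nat \<rightharpoonup> nat) \<Rightarrow> (nat \<Rightarrow> nat) set"
  where "Stab n f \<equiv> stabilizer (sym_group n) (conj_pt n) f"

definition centralizer :: "('a, 'b) monoid_scheme \<Rightarrow> 'a \<Rightarrow> 'a set"
  where "centralizer G x = {g \<in> carrier G. g \<otimes>\<^bsub>G\<^esub> x = x \<otimes>\<^bsub>G\<^esub> g}"

definition diag :: "nat \<Rightarrow> (nat \<Rightarrow> nat) \<Rightarrow> (nat \<rightharpoonup> nat) \<Rightarrow> (nat \<rightharpoonup> nat)"
  where "diag k s t = (\<lambda>i.
    if i \<in> {1..k} then Some (s i)
    else if k < i then map_option (\<lambda>j. k + j) (t (i - k))
    else None)"

text \<open>The embedding of \<open>S\<^sub>k \<times> S\<^sub>n\<^sub>-\<^sub>k\<close> into \<open>S\<^sub>n\<close>. It need not mention \<open>n\<close>, since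
  permutations fix everything outside their domain (in particular \<open>0\<close>).\<close>

definition block_perm :: "nat \<Rightarrow> (nat \<Rightarrow> nat) \<times> (nat \<Rightarrow> nat) \<Rightarrow> (nat \<Rightarrow> nat)"
  where "block_perm k = (\<lambda>(a, b) i. if i \<le> k then a i else k + b (i - k))"


lemma pt_of_perm_in_PT: "p permutes {1..n} \<Longrightarrow> pt_of_perm n p \<in> carrier (PT n)"
  unfolding PT_def partial_trans_def pt_of_perm_def dom_def ran_def
  by (auto split: if_splits simp del: atLeastAtMost_iff simp: permutes_in_image)

lemma pt_of_perm_comp:
  "q permutes {1..n} \<Longrightarrow> pt_of_perm n p \<circ>\<^sub>m pt_of_perm n q = pt_of_perm n (p \<circ> q)"
  unfolding pt_of_perm_def map_comp_def
  by (rule ext) (simp del: atLeastAtMost_iff add: permutes_in_image)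

lemma monoid_PT: "monoid (PT n)"
proof (rule monoidI)
  fix f g assume "f \<in> carrier (PT n)" "g \<in> carrier (PT n)"
  then show "f \<otimes>\<^bsub>PT n\<^esub> g \<in> carrier (PT n)"
    by (fastforce simp: PT_def partial_trans_def map_comp_def dom_def ran_def split: option.splits)
next
  show "\<one>\<^bsub>PT n\<^esub> \<in> carrier (PT n)"
    using pt_of_perm_in_PT[OF permutes_id] by (simp add: PT_def)
next
  fix f assume "f \<in> carrier (PT n)"
  then show "\<one>\<^bsub>PT n\<^esub> \<otimes>\<^bsub>PT n\<^esub> f = f"
    by (fastforce simp: PT_def partial_trans_def pt_of_perm_def map_comp_def ran_def
        split: option.splits)
next
  fix f assume "f \<in> carrier (PT n)"
  then have "f i = None" if "i \<notin> {1..n}" for i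
    using that by (auto simp: PT_def partial_trans_def)
  then show "f \<otimes>\<^bsub>PT n\<^esub> \<one>\<^bsub>PT n\<^esub> = f"
    by (auto simp: PT_def pt_of_perm_def map_comp_def fun_eq_iff)
qed (auto simp: PT_def map_comp_def split: option.splits)

lemma diag_in_PT:
  assumes "k \<le> n" "s \<in> carrier (sym_group k)" "t \<in> carrier (PT (n - k))"
  shows "diag k s t \<in> carrier (PT n)"
proof -
  have s: "s i \<in> {1..k}" if "i \<in> {1..k}" for i
    using assms(2) that permutes_in_image by (fastforce simp: sym_group_carrier)
  have "i \<in> {1..n} \<and> y \<in> {1..n}" if "diag k s t i = Some y" for i y
  proof (cases "i \<in> {1..k}")
    case True
    then show ?thesis using that s[of i] assms(1) by (auto simp: diag_def)
  next
    case False
    then have "(if k < i then map_option (\<lambda>j. k + j) (t (i - k)) else None) = Some y"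
      using that unfolding diag_def by (simp only: if_False)
    then obtain j where j: "k < i" "t (i - k) = Some j" "y = k + j"
      by (cases "k < i") auto
    then have "i - k \<in> {1..n-k}" "j \<in> {1..n-k}"
      using assms(3) unfolding PT_def partial_trans_def by (auto simp: dom_def ran_def)
    then show ?thesis using j by auto
  qed
  then show ?thesis by (auto simp: PT_def partial_trans_def dom_def ran_def)
qed

lemma group_action_conj_pt: "group_action (sym_group n) (carrier (PT n)) (conj_pt n)"
proof -
  interpret M: monoid "PT n" by (rule monoid_PT)
  interpret S: group "sym_group n" by (rule sym_group_is_group)
  let ?e = "pt_of_perm n" and ?S = "carrier (sym_group n)" and ?P = "carrier (PT n)"
  have e_in: "?e p \<in> ?P" if "p \<in> ?S" for p
    using that pt_of_perm_in_PT by (simp add: sym_group_carrier)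
  have e_mult: "?e (p \<otimes>\<^bsub>sym_group n\<^esub> q) = ?e p \<otimes>\<^bsub>PT n\<^esub> ?e q"
    if "p \<in> ?S" "q \<in> ?S" for p q
    using that pt_of_perm_comp[of q n p] by (simp add: sym_group_carrier sym_group_mult PT_def)
  have e_one: "?e \<one>\<^bsub>sym_group n\<^esub> = \<one>\<^bsub>PT n\<^esub>"
    by (simp add: sym_group_one PT_def)
  have cl: "conj_pt n p f \<in> ?P" if "p \<in> ?S" "f \<in> ?P" for p f
    using that e_in unfolding conj_pt_def by (simp del: sym_group_inv_equality)
  have comp: "conj_pt n p (conj_pt n q f) = conj_pt n (p \<otimes>\<^bsub>sym_group n\<^esub> q) f"
    if "p \<in> ?S" "q \<in> ?S" "f \<in> ?P" for p q f
    using that e_in cl[OF that(2,3)]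
    by (simp add: conj_pt_def e_mult S.inv_mult_group M.m_assoc del: sym_group_inv_equality)
  have one: "conj_pt n \<one>\<^bsub>sym_group n\<^esub> f = f" if "f \<in> ?P" for f
    using that by (simp add: conj_pt_def e_one del: sym_group_inv_equality)
  have bij: "conj_pt n p \<in> Bij ?P" if p: "p \<in> ?S" for p
  proof -
    have ip: "inv\<^bsub>sym_group n\<^esub> p \<in> ?S" using p by (rule S.inv_closed)
    have "bij_betw (conj_pt n p) ?P ?P"
      by (rule bij_betw_byWitness[where f' = "conj_pt n (inv\<^bsub>sym_group n\<^esub> p)"])
        (use p ip in \<open>auto simp: comp one cl S.r_inv S.l_inv simp del: sym_group_inv_equality\<close>)
    then show ?thesis by (simp add: Bij_def conj_pt_def)
  qed
  show ?thesis
  proof (intro group_action.intro group_hom.intro group_hom_axioms.intro homI)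
    fix p q assume pq: "p \<in> ?S" "q \<in> ?S"
    have "conj_pt n (p \<otimes>\<^bsub>sym_group n\<^esub> q) f = compose ?P (conj_pt n p) (conj_pt n q) f" for f
      using pq comp[of p q f] by (cases "f \<in> ?P") (auto simp: compose_def conj_pt_def)
    then show "conj_pt n (p \<otimes>\<^bsub>sym_group n\<^esub> q)
        = conj_pt n p \<otimes>\<^bsub>BijGroup ?P\<^esub> conj_pt n q"
      using bij pq by (auto simp: BijGroup_def)
  qed (use bij in \<open>auto simp: BijGroup_def sym_group_is_group
          intro: group_BijGroup[unfolded BijGroup_def]\<close>)
qed

lemma block_perm_permutes:
  assumes "k \<le> n" "a permutes {1..k}" "b permutes {1..n-k}"
  shows "block_perm k (a, b) permutes {1..n}" and "block_perm k (a, b) ` {1..k} = {1..k}"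
proof -
  have comp: "block_perm k (a, b) (block_perm k (a', b') i) = block_perm k (a \<circ> a', b \<circ> b') i"
    if "a' permutes {1..k}" "b' permutes {1..n-k}" for a b a' b' i
  proof -
    have "a' i \<le> k" if "i \<le> k"
      using \<open>a' permutes {1..k}\<close> that permutes_in_image[of a' "{1..k}" i]
      by (cases "i = 0") (auto simp: permutes_def)
    moreover have "b' (i - k) > 0" if "\<not> i \<le> k"
      using \<open>b' permutes {1..n-k}\<close> that permutes_in_image[of b' "{1..n-k}" "i - k"]
      by (cases "i - k \<in> {1..n-k}") (auto simp: permutes_def)
    ultimately show ?thesis by (auto simp: block_perm_def)
  qed
  have id: "block_perm k (id, id) i = i" for i by (auto simp: block_perm_def)
  have "bij (block_perm k (a, b))"
    by (rule bij_betw_byWitness[where f' = "block_perm k (inv' a, inv' b)"])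
      (use assms in \<open>auto simp: comp permutes_inv permutes_inv_o id\<close>)
  moreover have "block_perm k (a, b) i = i" if "i \<notin> {1..n}" for i
  proof (cases "i \<le> k")
    case True
    then have "i \<notin> {1..k}" using that assms(1) by auto
    then show ?thesis using True assms(2) by (simp add: block_perm_def permutes_not_in)
  next
    case False
    then have "i - k \<notin> {1..n-k}" using that assms(1) by auto
    then show ?thesis using False assms(3) by (simp add: block_perm_def permutes_not_in)
  qed
  ultimately show "block_perm k (a, b) permutes {1..n}"
    unfolding permutes_def bij_iff by blast
  have "block_perm k (a, b) ` {1..k} = a ` {1..k}"
    by (rule image_cong) (auto simp: block_perm_def)
  then show "block_perm k (a, b) ` {1..k} = {1..k}"
    using permutes_image[OF assms(2)] by simp
qed

lemma block_perm_iso: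
  assumes "k \<le> n"
  shows "block_perm k \<in> iso (sym_group k \<times>\<times> sym_group (n - k))
    (sym_group n\<lparr>carrier := {p \<in> carrier (sym_group n). p ` {1..k} = {1..k}}\<rparr>)"
    (is "_ \<in> iso ?G ?H")
proof -
  have hom: "block_perm k \<in> hom ?G ?H"
  proof (rule homI)
    fix x assume "x \<in> carrier ?G"
    then show "block_perm k x \<in> carrier ?H"
      using assms block_perm_permutes by (cases x) (auto simp: sym_group_carrier)
  next
    fix x y assume "x \<in> carrier ?G" "y \<in> carrier ?G"
    then obtain a b a' b' where xy: "x = (a, b)" "y = (a', b')"
      and p: "a' permutes {1..k}" "b' permutes {1..n-k}"
      by (cases x; cases y) (auto simp: sym_group_carrier)
    have A: "a' i \<le> k" if "i \<le> k" for i
      using p that permutes_in_image[of a' "{1..k}" i]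
      by (cases "i = 0") (auto simp: permutes_def)
    have B: "b' (i - k) > 0" if "\<not> i \<le> k" for i
      using p that permutes_in_image[of b' "{1..n-k}" "i - k"]
      by (cases "i - k \<in> {1..n-k}") (auto simp: permutes_def)
    have "block_perm k (a \<circ> a', b \<circ> b') i = (block_perm k (a, b) \<circ> block_perm k (a', b')) i" for i
      using A[of i] B[of i] by (cases "i \<le> k") (simp_all add: block_perm_def)
    then show "block_perm k (x \<otimes>\<^bsub>?G\<^esub> y) = block_perm k x \<otimes>\<^bsub>?H\<^esub> block_perm k y"
      by (simp add: xy sym_group_mult fun_eq_iff)
  qed
  moreover have "inj_on (block_perm k) (carrier ?G)"
  proof (rule inj_onI, clarsimp simp: sym_group_carrier)
    fix a b a' b'
    assume p: "a permutes {Suc 0..k}" "b permutes {Suc 0..n-k}"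
        "a' permutes {Suc 0..k}" "b' permutes {Suc 0..n-k}"
      and eq: "block_perm k (a, b) = block_perm k (a', b')"
    have "a i = a' i" for i
      using fun_cong[OF eq, of i] p
      by (cases "i \<le> k") (auto simp: block_perm_def permutes_not_in)
    moreover have "b i = b' i" for i
      using fun_cong[OF eq, of "k + i"] p
      by (cases "i = 0") (auto simp: block_perm_def permutes_not_in)
    ultimately show "a = a' \<and> b = b'" by auto
  qed
  moreover have "carrier ?H \<subseteq> block_perm k ` carrier ?G"
  proof
    fix p assume "p \<in> carrier ?H"
    then have p: "p permutes {1..n}" and pk: "p ` {1..k} = {1..k}"
      by (auto simp: sym_group_carrier)
    define a where "a = (\<lambda>i. if i \<in> {1..k} then p i else i)"
    define b where "b = (\<lambda>j. if j \<in> {1..n-k} then p (k + j) - k else j)"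
    have inj: "inj p" using p permutes_inj by blast
    have up: "p i \<in> {k+1..n}" if "i \<in> {k+1..n}" for i
    proof -
      have "p i \<in> {1..n}" using permutes_in_image[OF p] that by auto
      moreover have "p i \<notin> {1..k}"
      proof
        assume "p i \<in> {1..k}"
        then have "p i \<in> p ` {1..k}" using pk by simp
        then have "i \<in> {1..k}" using inj by (simp only: inj_image_mem_iff)
        then show False using that by simp
      qed
      ultimately show ?thesis by auto
    qed
    have "bij_betw a {1..k} {1..k}"
      using pk inj by (auto simp: bij_betw_def a_def inj_on_def dest: injD)
    then have a: "a permutes {1..k}" by (rule bij_imp_permutes) (auto simp: a_def)
    have "inj_on b {1..n-k}"
    proof (rule inj_onI)
      fix i j assume ij: "i \<in> {1..n-k}" "j \<in> {1..n-k}" "b i = b j"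
      then have "p (k+i) \<in> {k+1..n}" "p (k+j) \<in> {k+1..n}"
        using up by auto
      then have "p (k + i) = p (k + j)" using ij by (auto simp: b_def)
      then have "k + i = k + j" by (rule injD[OF inj])
      then show "i = j" by simp
    qed
    moreover have "b ` {1..n-k} \<subseteq> {1..n-k}"
    proof
      fix y assume "y \<in> b ` {1..n-k}"
      then obtain j where "j \<in> {1..n-k}" "y = p (k + j) - k" by (auto simp: b_def)
      then show "y \<in> {1..n-k}" using up[of "k + j"] assms by (auto simp: le_diff_conv2)
    qed
    ultimately have "bij_betw b {1..n-k} {1..n-k}"
      by (simp add: bij_betw_def endo_inj_surj)
    then have b: "b permutes {1..n-k}" by (rule bij_imp_permutes) (auto simp: b_def)
    have "block_perm k (a, b) i = p i" for i
    proof -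
      consider "i = 0" | "i \<in> {1..k}" | "i \<in> {k+1..n}" | "i > n" using assms by fastforce
      then show ?thesis
      proof cases
        case 3
        then show ?thesis using up[of i] by (auto simp: block_perm_def b_def)
      qed (use assms permutes_not_in[OF p, of i] in \<open>auto simp: block_perm_def a_def b_def\<close>)
    qed
    then have "p = block_perm k (a, b)" by auto
    then show "p \<in> block_perm k ` carrier ?G"
      using a b by (auto simp: sym_group_carrier)
  qed
  ultimately show ?thesis
    unfolding iso_iff using hom_carrier[OF hom] by blast
qed

end

theory Submission
  imports Defs
begin

text \<open>The stabilizer of \<open>f\<close> consists of the permutations commuting with \<open>f\<close>, and these commute
  with every power of \<open>f\<close>. As \<open>\<tau>\<close> is nilpotent, some power of \<open>f = diag(\<sigma>, \<tau>)\<close> has domain exactly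
  \<open>{1..k}\<close>, so the stabilizer preserves \<open>{1..k}\<close> and consists of block permutations. Such a
  permutation \<open>(a, b)\<close> is itself \<open>diag(a, b)\<close>, and products of block diagonal maps are computed
  blockwise; hence it commutes with \<open>f\<close> exactly when \<open>a\<close> commutes with \<open>\<sigma>\<close> and \<open>b\<close> with \<open>\<tau>\<close>.\<close>

section \<open>Stabilizers as commuting permutations\<close>

lemma pt_of_perm_mult:
  assumes "p \<in> carrier (sym_group n)" "q \<in> carrier (sym_group n)"
  shows "pt_of_perm n (p \<otimes>\<^bsub>sym_group n\<^esub> q) = pt_of_perm n p \<otimes>\<^bsub>PT n\<^esub> pt_of_perm n q"
  using assms pt_of_perm_comp[of q n p] by (simp add: sym_group_carrier sym_group_mult PT_def)

text \<open>\<open>PT n\<close> is only a monoid, so cancellation relies on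
  \<open>pt_of_perm n\<close> being multiplicative: it sends the inverse permutation to a two-sided
  inverse of \<open>pt_of_perm n p\<close>. The inverse-free form passes to powers and can be
  compared block by block.\<close>

lemma mem_Stab_iff_commutes:
  assumes f: "f \<in> carrier (PT n)"
  shows "p \<in> Stab n f \<longleftrightarrow> p \<in> carrier (sym_group n) \<and>
    pt_of_perm n p \<otimes>\<^bsub>PT n\<^esub> f = f \<otimes>\<^bsub>PT n\<^esub> pt_of_perm n p"
proof -
  interpret M: monoid "PT n" by (rule monoid_PT)
  interpret S: group "sym_group n" by (rule sym_group_is_group)
  let ?e = "pt_of_perm n"
  have "conj_pt n p f = f \<longleftrightarrow> ?e p \<otimes>\<^bsub>PT n\<^esub> f = f \<otimes>\<^bsub>PT n\<^esub> ?e p"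
    if p: "p \<in> carrier (sym_group n)"
  proof -
    let ?q = "inv\<^bsub>sym_group n\<^esub> p"
    have q: "?q \<in> carrier (sym_group n)" using p by (rule S.inv_closed)
    \<comment> \<open>Simplification with \<open>sym_group_inv_equality\<close> would turn the group
      inverse into the inverse function, out of reach of the group laws; hence its deletion here and
      below.\<close>
    have P: "?e p \<in> carrier (PT n)" "?e ?q \<in> carrier (PT n)"
      using p q pt_of_perm_in_PT by (simp_all add: sym_group_carrier del: sym_group_inv_equality)
    have one: "?e \<one>\<^bsub>sym_group n\<^esub> = \<one>\<^bsub>PT n\<^esub>" by (simp add: sym_group_one PT_def)
    have l: "?e ?q \<otimes>\<^bsub>PT n\<^esub> ?e p = \<one>\<^bsub>PT n\<^esub>"
      using pt_of_perm_mult[OF q p] p by (simp add: one del: sym_group_inv_equality)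
    have r: "?e p \<otimes>\<^bsub>PT n\<^esub> ?e ?q = \<one>\<^bsub>PT n\<^esub>"
      using pt_of_perm_mult[OF p q] p by (simp add: one del: sym_group_inv_equality)
    have c: "conj_pt n p f = ?e p \<otimes>\<^bsub>PT n\<^esub> f \<otimes>\<^bsub>PT n\<^esub> ?e ?q"
      using f by (simp add: conj_pt_def del: sym_group_inv_equality)
    show ?thesis
    proof
      assume "conj_pt n p f = f"
      then have "f \<otimes>\<^bsub>PT n\<^esub> ?e p = ?e p \<otimes>\<^bsub>PT n\<^esub> f \<otimes>\<^bsub>PT n\<^esub> ?e ?q \<otimes>\<^bsub>PT n\<^esub> ?e p"
        using c by simp
      also have "\<dots> = ?e p \<otimes>\<^bsub>PT n\<^esub> f"
        using f P l by (simp add: M.m_assoc del: sym_group_inv_equality)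
      finally show "?e p \<otimes>\<^bsub>PT n\<^esub> f = f \<otimes>\<^bsub>PT n\<^esub> ?e p" by simp
    next
      assume "?e p \<otimes>\<^bsub>PT n\<^esub> f = f \<otimes>\<^bsub>PT n\<^esub> ?e p"
      then show "conj_pt n p f = f"
        using c f P r by (simp add: M.m_assoc del: sym_group_inv_equality)
    qed
  qed
  then show ?thesis by (auto simp: stabilizer_def)
qed

text \<open>Only an inclusion, since powers can gain symmetry: the power \<open>0\<close> is the
  identity, which every permutation stabilizes.\<close>

lemma Stab_subset_Stab_pow:
  assumes f: "f \<in> carrier (PT n)"
  shows "Stab n f \<subseteq> Stab n (f [^]\<^bsub>PT n\<^esub> (m::nat))"
proof
  interpret M: monoid "PT n" by (rule monoid_PT)
  fix p assume "p \<in> Stab n f"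
  then have p: "p \<in> carrier (sym_group n)"
    and c: "pt_of_perm n p \<otimes>\<^bsub>PT n\<^esub> f = f \<otimes>\<^bsub>PT n\<^esub> pt_of_perm n p"
    by (simp_all add: mem_Stab_iff_commutes[OF f])
  have P: "pt_of_perm n p \<in> carrier (PT n)"
    using p pt_of_perm_in_PT by (simp add: sym_group_carrier)
  have "pt_of_perm n p \<otimes>\<^bsub>PT n\<^esub> f [^]\<^bsub>PT n\<^esub> m = f [^]\<^bsub>PT n\<^esub> m \<otimes>\<^bsub>PT n\<^esub> pt_of_perm n p"
  proof (induction m)
    case 0
    then show ?case using P by simp
  next
    case (Suc m)
    have "pt_of_perm n p \<otimes>\<^bsub>PT n\<^esub> f [^]\<^bsub>PT n\<^esub> Suc m
        = f [^]\<^bsub>PT n\<^esub> m \<otimes>\<^bsub>PT n\<^esub> pt_of_perm n p \<otimes>\<^bsub>PT n\<^esub> f"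
      using Suc P f by (simp flip: M.m_assoc)
    then show ?case using P f c by (simp add: M.m_assoc)
  qed
  then show "p \<in> Stab n (f [^]\<^bsub>PT n\<^esub> m)"
    using p f by (simp add: mem_Stab_iff_commutes)
qed

text \<open>Where \<open>g i\<close> is defined, commutation gives \<open>g (p i)\<close> the value
  \<open>p (g i)\<close>, so \<open>p\<close> maps \<open>dom g\<close> into itself. An injective
  self-map of a finite set is onto.\<close>

lemma Stab_image_dom:
  assumes g: "g \<in> carrier (PT n)" and p: "p \<in> Stab n g"
  shows "p ` dom g = dom g"
proof -
  have perm: "p permutes {1..n}"
    and c: "pt_of_perm n p \<circ>\<^sub>m g = g \<circ>\<^sub>m pt_of_perm n p"
    using p by (simp_all add: mem_Stab_iff_commutes[OF g] sym_group_carrier PT_def)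
  have dom: "dom g \<subseteq> {1..n}" and ran: "ran g \<subseteq> {1..n}"
    using g by (auto simp: PT_def partial_trans_def)
  have "p ` dom g \<subseteq> dom g"
  proof
    fix y assume "y \<in> p ` dom g"
    then obtain i z where i: "y = p i" "g i = Some z" by auto
    \<comment> \<open>\<open>pt_of_perm n p\<close> is undefined outside \<open>{1..n}\<close>, so
      both points at which it is evaluated must be placed there.\<close>
    moreover have "i \<in> {1..n}" "z \<in> {1..n}" using i dom ran by (auto simp: ran_def)
    ultimately have "Some (p z) = g y"
      using fun_cong[OF c, of i] by (simp add: pt_of_perm_def map_comp_def)
    then show "y \<in> dom g" by (metis domI)
  qed
  moreover have "finite (dom g)" using dom finite_subset by blast
  ultimately show ?thesis
    using permutes_inj[OF perm] by (intro endo_inj_surj) (auto intro: inj_on_subset)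
qed

section \<open>Calculus of block diagonal maps\<close>

lemma diag_comp:
  assumes "s' permutes {1..k}" "t' \<in> carrier (PT m)"
  shows "diag k s t \<circ>\<^sub>m diag k s' t' = diag k (s \<circ> s') (t \<circ>\<^sub>m t')"
proof
  fix i
  have s': "s' i \<in> {1..k} \<longleftrightarrow> i \<in> {1..k}" using assms(1) by (rule permutes_in_image)
  \<comment> \<open>The inner map must keep each index in its block. A value \<open>0\<close> of
    \<open>t'\<close> would become \<open>k + 0\<close>, which the outer \<open>diag\<close> does
    not read as an index of the second block.\<close>
  have t': "0 < j" if "t' l = Some j" for l j
    using that assms(2) by (force simp: PT_def partial_trans_def ran_def)
  consider "i \<in> {1..k}" | "i = 0" | "k < i" by fastforce
  then show "(diag k s t \<circ>\<^sub>m diag k s' t') i = diag k (s \<circ> s') (t \<circ>\<^sub>m t') i"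
  proof cases
    case 1
    with s' have "s' i \<in> {1..k}" by blast
    with 1 show ?thesis by (simp add: diag_def map_comp_def)
  next
    case 2
    then show ?thesis by (simp add: diag_def map_comp_def)
  next
    case 3
    then show ?thesis
      using t'[of "i - k"] by (cases "t' (i - k)") (simp_all add: diag_def map_comp_def)
  qed
qed

lemma diag_mult:
  assumes "k \<le> n" "s' \<in> carrier (sym_group k)" "t' \<in> carrier (PT (n - k))"
  shows "diag k s t \<otimes>\<^bsub>PT n\<^esub> diag k s' t'
    = diag k (s \<otimes>\<^bsub>sym_group k\<^esub> s') (t \<otimes>\<^bsub>PT (n - k)\<^esub> t')"
  using assms diag_comp[of s' k t'] by (simp add: sym_group_carrier sym_group_mult PT_def)

text \<open>Brings block permutations into the form to which \<open>diag_mult\<close> applies, so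
  that both sides of a commutation equation become block diagonal.\<close>

lemma pt_of_perm_block_perm:
  assumes "k \<le> n"
  shows "pt_of_perm n (block_perm k (a, b)) = diag k a (pt_of_perm (n - k) b)"
  using assms by (auto simp: pt_of_perm_def block_perm_def diag_def fun_eq_iff)

lemma diag_pow:
  assumes "k \<le> n" "s \<in> carrier (sym_group k)" "t \<in> carrier (PT (n - k))"
  shows "diag k s t [^]\<^bsub>PT n\<^esub> (m::nat)
    = diag k (s [^]\<^bsub>sym_group k\<^esub> m) (t [^]\<^bsub>PT (n - k)\<^esub> m)"
proof (induction m)
  case 0
  \<comment> \<open>The unit of \<open>PT n\<close> is \<open>pt_of_perm n id\<close>; reading
    \<open>id\<close> as a block permutation exhibits this unit as block diagonal with unit
    blocks.\<close>
  have "block_perm k (id, id) = id" by (auto simp: block_perm_def)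
  then show ?case
    using pt_of_perm_block_perm[OF assms(1), of id id]
    by (simp add: PT_def sym_group_one nat_pow_def id_def)
next
  case (Suc m)
  then show ?case
    using assms by (simp add: diag_mult)
qed

text \<open>\<open>diag\<close> reads \<open>s\<close> only on \<open>{1..k}\<close> and
  \<open>t\<close> only at positive arguments. Elsewhere the conventions fix the values:
  permutations are the identity outside \<open>{1..k}\<close>, and partial transformations are
  undefined at \<open>0\<close>.\<close>

lemma diag_inject:
  assumes "s permutes {1..k}" "s' permutes {1..k}"
    and "t \<in> carrier (PT m)" "t' \<in> carrier (PT m)"
  shows "diag k s t = diag k s' t' \<longleftrightarrow> s = s' \<and> t = t'"
proof
  assume eq: "diag k s t = diag k s' t'"
  have "s i = s' i" for i
    using fun_cong[OF eq, of i] assms(1,2)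
    by (cases "i \<in> {1..k}") (auto simp: diag_def permutes_not_in)
  moreover have "t j = t' j" for j
  proof (cases "j = 0")
    case True
    have "dom t \<subseteq> {1..m}" "dom t' \<subseteq> {1..m}"
      using assms(3,4) by (simp_all add: PT_def partial_trans_def)
    then have "0 \<notin> dom t" "0 \<notin> dom t'"
      by (meson atLeastAtMost_iff in_mono not_one_le_zero)+
    then show ?thesis using True by (simp add: domIff)
  next
    case False
    then have "map_option ((+) k) (t j) = map_option ((+) k) (t' j)"
      using fun_cong[OF eq, of "k + j"] by (simp add: diag_def)
    then show ?thesis by (cases "t j"; cases "t' j") simp_all
  qed
  ultimately show "s = s' \<and> t = t'" by auto
qed simp

section \<open>The stabilizer of a block diagonal map\<close>

lemma block_perm_mem_Stab_diag_iff:
  assumes k: "k \<le> n" and s: "s \<in> carrier (sym_group k)" and t: "t \<in> carrier (PT (n - k))"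
    and a: "a \<in> carrier (sym_group k)" and b: "b \<in> carrier (sym_group (n - k))"
  shows "block_perm k (a, b) \<in> Stab n (diag k s t)
    \<longleftrightarrow> a \<in> centralizer (sym_group k) s \<and> b \<in> Stab (n - k) t"
proof -
  interpret S: group "sym_group k" by (rule sym_group_is_group)
  interpret M: monoid "PT (n - k)" by (rule monoid_PT)
  let ?B = "pt_of_perm (n - k) b"
  have B: "?B \<in> carrier (PT (n - k))"
    using b pt_of_perm_in_PT by (simp add: sym_group_carrier)
  have "block_perm k (a, b) \<in> carrier (sym_group n)"
    using block_perm_permutes(1)[OF k] a b by (simp add: sym_group_carrier)
  then have "block_perm k (a, b) \<in> Stab n (diag k s t) \<longleftrightarrow>
      diag k (a \<otimes>\<^bsub>sym_group k\<^esub> s) (?B \<otimes>\<^bsub>PT (n - k)\<^esub> t)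
      = diag k (s \<otimes>\<^bsub>sym_group k\<^esub> a) (t \<otimes>\<^bsub>PT (n - k)\<^esub> ?B)"
    using k s t a B
    by (simp add: mem_Stab_iff_commutes diag_in_PT pt_of_perm_block_perm diag_mult)
  also have "\<dots> \<longleftrightarrow> a \<otimes>\<^bsub>sym_group k\<^esub> s = s \<otimes>\<^bsub>sym_group k\<^esub> a
      \<and> ?B \<otimes>\<^bsub>PT (n - k)\<^esub> t = t \<otimes>\<^bsub>PT (n - k)\<^esub> ?B"
  proof (rule diag_inject[where m = "n - k"])
    show "a \<otimes>\<^bsub>sym_group k\<^esub> s permutes {1..k}" "s \<otimes>\<^bsub>sym_group k\<^esub> a permutes {1..k}"
      using S.m_closed[OF a s] S.m_closed[OF s a] by (simp_all add: sym_group_carrier)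
  qed (use t B in simp_all)
  also have "\<dots> \<longleftrightarrow> a \<in> centralizer (sym_group k) s \<and> b \<in> Stab (n - k) t"
    using a b by (simp add: centralizer_def mem_Stab_iff_commutes[OF t])
  finally show ?thesis .
qed

lemma Stab_diag_nilpotent_preserves:
  assumes k: "k \<le> n" and s: "s \<in> carrier (sym_group k)" and t: "t \<in> nilpotent_pts (n - k)"
    and p: "p \<in> Stab n (diag k s t)"
  shows "p ` {1..k} = {1..k}"
proof -
  interpret M: monoid "PT n" by (rule monoid_PT)
  obtain m :: nat where tP: "t \<in> carrier (PT (n - k))"
    and m: "t [^]\<^bsub>PT (n - k)\<^esub> m = Map.empty"
    using t by (auto simp: nilpotent_pts_def)
  let ?g = "diag k s t [^]\<^bsub>PT n\<^esub> m"
  have f: "diag k s t \<in> carrier (PT n)" using k s tP by (rule diag_in_PT)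
  then have "?g \<in> carrier (PT n)" by simp
  moreover have "p \<in> Stab n ?g" using p Stab_subset_Stab_pow[OF f] by blast
  ultimately have "p ` dom ?g = dom ?g" by (rule Stab_image_dom)
  \<comment> \<open>The power of \<open>s\<close> still fills all of \<open>{1..k}\<close>, while
    the second block has become the empty map.\<close>
  moreover have "dom ?g = {1..k}"
    unfolding diag_pow[OF k s tP] m by (auto simp: diag_def split: if_splits)
  ultimately show ?thesis by simp
qed

theorem theorem3p2:
  fixes k n :: nat and \<sigma> :: "nat \<Rightarrow> nat" and \<tau> f :: "nat \<rightharpoonup> nat"
  assumes "k \<le> n"
    and "\<sigma> \<in> carrier (sym_group k)"
    and "\<tau> \<in> nilpotent_pts (n - k)"
    and "f = diag k \<sigma> \<tau>"
  shows "Stab n f = block_perm k ` (centralizer (sym_group k) \<sigma> \<times> Stab (n - k) \<tau>)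
    \<and> block_perm k \<in>
      iso (sym_group k\<lparr>carrier := centralizer (sym_group k) \<sigma>\<rparr>
            \<times>\<times> sym_group (n - k)\<lparr>carrier := Stab (n - k) \<tau>\<rparr>)
          (sym_group n\<lparr>carrier := Stab n f\<rparr>)"
proof -
  let ?C = "centralizer (sym_group k) \<sigma>" and ?T = "Stab (n - k) \<tau>"
  let ?G = "sym_group k \<times>\<times> sym_group (n - k)"
  let ?H = "sym_group n\<lparr>carrier := {p \<in> carrier (sym_group n). p ` {1..k} = {1..k}}\<rparr>"
  have \<tau>: "\<tau> \<in> carrier (PT (n - k))" using assms(3) by (simp add: nilpotent_pts_def)
  \<comment> \<open>\<open>?H\<close> is the setwise stabilizer of \<open>{1..k}\<close>. The
    required isomorphism is the restriction of \<open>block_perm_iso\<close> to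
    \<open>?C \<times> ?T\<close>.\<close>
  have hom: "block_perm k \<in> hom ?G ?H" and inj: "inj_on (block_perm k) (carrier ?G)"
    and surj: "block_perm k ` carrier ?G = carrier ?H"
    using block_perm_iso[OF assms(1)] unfolding iso_iff by blast+
  have sub: "?C \<times> ?T \<subseteq> carrier ?G" by (auto simp: centralizer_def stabilizer_def)
  have mem: "block_perm k x \<in> Stab n f \<longleftrightarrow> x \<in> ?C \<times> ?T" if "x \<in> carrier ?G" for x
    using that block_perm_mem_Stab_diag_iff[OF assms(1,2) \<tau>]
    by (cases x) (simp add: assms(4))
  \<comment> \<open>Nilpotency enters here. For \<open>k = 1\<close>, \<open>n = 2\<close> and
    \<tau> the identity, \<open>f\<close> would be the identity and the transposition, which moves
    \<open>1\<close>, would stabilize it.\<close>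
  have "Stab n f \<subseteq> carrier ?H"
  proof
    fix p assume p: "p \<in> Stab n f"
    then have "p ` {1..k} = {1..k}"
      unfolding assms(4) by (rule Stab_diag_nilpotent_preserves[OF assms(1-3)])
    with p show "p \<in> carrier ?H" by (simp add: stabilizer_def)
  qed
  then have S: "Stab n f \<subseteq> block_perm k ` carrier ?G" by (simp only: surj)
  have eq: "Stab n f = block_perm k ` (?C \<times> ?T)"
  proof (intro equalityI subsetI)
    fix p assume p: "p \<in> Stab n f"
    with S obtain x where x: "x \<in> carrier ?G" "p = block_perm k x" by (meson imageE subsetD)
    with p have "x \<in> ?C \<times> ?T" using mem by metis
    with x(2) show "p \<in> block_perm k ` (?C \<times> ?T)" by (rule image_eqI)
  next
    fix p assume "p \<in> block_perm k ` (?C \<times> ?T)"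
    then obtain x where x: "x \<in> ?C \<times> ?T" "p = block_perm k x" by (rule imageE)
    then have "x \<in> carrier ?G" using sub by (meson subsetD)
    then show "p \<in> Stab n f" using mem x by metis
  qed
  \<comment> \<open>Changing carriers leaves the multiplications alone, so the homomorphism law is
    inherited from \<open>hom\<close>; that the values lie in the stabilizer is
    \<open>eq\<close>.\<close>
  have "block_perm k \<in> hom (sym_group k\<lparr>carrier := ?C\<rparr> \<times>\<times> sym_group (n - k)\<lparr>carrier := ?T\<rparr>)
      (sym_group n\<lparr>carrier := Stab n f\<rparr>)"
  proof (rule homI)
    fix x y
    assume "x \<in> carrier (sym_group k\<lparr>carrier := ?C\<rparr> \<times>\<times> sym_group (n - k)\<lparr>carrier := ?T\<rparr>)"
      and "y \<in> carrier (sym_group k\<lparr>carrier := ?C\<rparr> \<times>\<times> sym_group (n - k)\<lparr>carrier := ?T\<rparr>)"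
    then have "x \<in> carrier ?G" "y \<in> carrier ?G" using sub by auto
    then show "block_perm k
        (x \<otimes>\<^bsub>sym_group k\<lparr>carrier := ?C\<rparr> \<times>\<times> sym_group (n - k)\<lparr>carrier := ?T\<rparr>\<^esub> y)
      = block_perm k x \<otimes>\<^bsub>sym_group n\<lparr>carrier := Stab n f\<rparr>\<^esub> block_perm k y"
      using hom_mult[OF hom, of x y] by (simp add: DirProd_def)
  qed (use eq in auto)
  moreover have "inj_on (block_perm k) (?C \<times> ?T)"
    using inj sub by (rule inj_on_subset)
  ultimately show ?thesis
    using eq unfolding iso_iff by simp
qed

end
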